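(* Let $m,n$ be positive integers and let $\mathcal{A}^I=[\underline{\mathcal{A}},\overline{\mathcal{A}}]$ be an interval Z-tensor in $T_{m,n}$. Then $\mathcal{A}^I$ is an interval double B-tensor if and only if $\underline{\mathcal{A}}$ is a double B-tensor.
   Context: $[n]=\{1,\dots,n\}$. $T_{m,n}$ is the set of real tensors $\mathcal{A}=(a_{i_1i_2\cdots i_m})$ with all indices in $[n]$; an entry is diagonal if all its indices are equal and off-diagonal otherwise. All index tuples $(i_2,\dots,i_m)$ range over $[n]^{m-1}$. For $\underline{\mathcal{A}}\le\overline{\mathcal{A}}$ in $T_{m,n}$ (entrywise), the interval tensor is $\mathcal{A}^I=[\underline{\mathcal{A}},\overline{\mathcal{A}}]=\{\mathcal{A}\in T_{m,n}:\underline{\mathcal{A}}\le\mathcal{A}\le\overline{\mathcal{A}}\}$. Z-tensor: all off-diagonal entries are $\le 0$. For $\mathcal{A}\in T_{m,n}$ and $i_1\in[n]$, $\gamma_{i_1}^+(\mathcal{A}):=\max\{0,a_{i_1i_2\cdots i_m}:(i_2,\dots,i_m)\neq(i_1,\dots,i_1)\}$. Double B-tensor: $\mathcal{A}\in T_{m,n}$ is a double B-tensor if for all $i_1\in[n]$: (i) $a_{i_1i_1\cdots i_1}>\gamma_{i_1}^+(\mathcal{A})$; (ii) $a_{i_1i_1\cdots i_1}-\gamma_{i_1}^+(\mathcal{A})\ge\sum_{(i_2,\dots,i_m)\neq(i_1,\dots,i_1)}(\gamma_{i_1}^+(\mathcal{A})-a_{i_1i_2\cdots i_m})$; (iii) for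 all $j_1\neq i_1$, $$(a_{i_1\cdots i_1}-\gamma_{i_1}^+(\mathcal{A}))(a_{j_1\cdots j_1}-\gamma_{j_1}^+(\mathcal{A}))>\Big(\sum_{(i_2,\dots,i_m)\neq(i_1,\dots,i_1)}(\gamma_{i_1}^+(\mathcal{A})-a_{i_1i_2\cdots i_m})\Big)\Big(\sum_{(j_2,\dots,j_m)\neq(j_1,\dots,j_1)}(\gamma_{j_1}^+(\mathcal{A})-a_{j_1j_2\cdots j_m})\Big).$$ $\mathcal{A}^I$ is an interval Z-tensor (resp. interval double B-tensor) if every $\mathcal{A}\in\mathcal{A}^I$ is a Z-tensor (resp. double B-tensor). *)

theory Defs
  imports Complex_Main "HOL-Library.FuncSet"
begin

text \<open>A tensor of order \<open>m\<close> and dimension \<open>n\<close> is a real function on the index tuples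
  \<open>[i\<^sub>1, \<dots>, i\<^sub>m]\<close> over \<open>{1..n}\<close>, taken extensional (\<open>undefined\<close> off the index set) so that
  equality of tensors is equality of entries. The order and the dimension are explicit
  parameters; the definitions below are meant for \<open>m \<ge> 1\<close>.\<close>

type_synonym tensor = "nat list \<Rightarrow> real"

definition index_tuples :: "nat \<Rightarrow> nat \<Rightarrow> nat list set" where
  "index_tuples k n = {t. length t = k \<and> set t \<subseteq> {1..n}}"

definition tensors :: "nat \<Rightarrow> nat \<Rightarrow> tensor set" where
  "tensors m n = (index_tuples m n \<rightarrow>\<^sub>E (UNIV :: real set))"

definition tensor_le :: "nat \<Rightarrow> nat \<Rightarrow> tensor \<Rightarrow> tensor \<Rightarrow> bool" where
  "tensor_le m n A B \<longleftrightarrow> (\<forall>t \<in> index_tuples m n. A t \<le> B t)"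

definition interval_tensor :: "nat \<Rightarrow> nat \<Rightarrow> tensor \<Rightarrow> tensor \<Rightarrow> tensor set" where
  "interval_tensor m n L U = {A \<in> tensors m n. tensor_le m n L A \<and> tensor_le m n A U}"

definition diagonal_index :: "nat list \<Rightarrow> bool" where
  "diagonal_index t \<longleftrightarrow> (\<exists>i. t = replicate (length t) i)"

definition Z_tensor :: "nat \<Rightarrow> nat \<Rightarrow> tensor \<Rightarrow> bool" where
  "Z_tensor m n A \<longleftrightarrow> A \<in> tensors m n \<and>
     (\<forall>t \<in> index_tuples m n. \<not> diagonal_index t \<longrightarrow> A t \<le> 0)"

text \<open>The tuples \<open>(i\<^sub>2, \<dots>, i\<^sub>m) \<noteq> (i, \<dots>, i)\<close>; for \<open>m = 1\<close> there are none, since the only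
  tuple of length \<open>0\<close> is the constant one.\<close>

definition offdiag_tuples :: "nat \<Rightarrow> nat \<Rightarrow> nat \<Rightarrow> nat list set" where
  "offdiag_tuples m n i = index_tuples (m - 1) n - {replicate (m - 1) i}"

definition diag_entry :: "nat \<Rightarrow> tensor \<Rightarrow> nat \<Rightarrow> real" where
  "diag_entry m A i = A (replicate m i)"

definition gamma_plus :: "nat \<Rightarrow> nat \<Rightarrow> tensor \<Rightarrow> nat \<Rightarrow> real" where
  "gamma_plus m n A i = Max (insert 0 ((\<lambda>t. A (i # t)) ` offdiag_tuples m n i))"

definition double_B_tensor :: "nat \<Rightarrow> nat \<Rightarrow> tensor \<Rightarrow> bool" where
  "double_B_tensor m n A \<longleftrightarrow> A \<in> tensors m n \<and>
     (\<forall>i \<in> {1..n}.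
        diag_entry m A i > gamma_plus m n A i \<and>
        diag_entry m A i - gamma_plus m n A i
          \<ge> (\<Sum>t \<in> offdiag_tuples m n i. gamma_plus m n A i - A (i # t)) \<and>
        (\<forall>j \<in> {1..n}. j \<noteq> i \<longrightarrow>
           (diag_entry m A i - gamma_plus m n A i) * (diag_entry m A j - gamma_plus m n A j)
             > (\<Sum>t \<in> offdiag_tuples m n i. gamma_plus m n A i - A (i # t))
               * (\<Sum>t \<in> offdiag_tuples m n j. gamma_plus m n A j - A (j # t))))"

definition interval_Z_tensor :: "nat \<Rightarrow> nat \<Rightarrow> tensor \<Rightarrow> tensor \<Rightarrow> bool" where
  "interval_Z_tensor m n L U \<longleftrightarrow> (\<forall>A \<in> interval_tensor m n L U. Z_tensor m n A)"

definition interval_double_B_tensor :: "nat \<Rightarrow> nat \<Rightarrow> tensor \<Rightarrow> tensor \<Rightarrow> bool" where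
  "interval_double_B_tensor m n L U \<longleftrightarrow> (\<forall>A \<in> interval_tensor m n L U. double_B_tensor m n A)"

end

theory Submission
  imports Defs
begin

text \<open>In a Z-tensor no off-diagonal entry is positive, so every \<open>\<gamma>\<^sub>i\<^sup>+\<close> is \<open>0\<close> and the
  double B-conditions become a form of diagonal dominance for pairs of rows: with \<open>d\<^sub>i\<close> the diagonal
  entry and \<open>r\<^sub>i\<close> the sum of the moduli of the off-diagonal entries of row \<open>i\<close>, they say
  \<open>d\<^sub>i > 0\<close>, \<open>d\<^sub>i \<ge> r\<^sub>i\<close> and \<open>d\<^sub>i d\<^sub>j > r\<^sub>i r\<^sub>j\<close>. Increasing entries, while keeping the
  off-diagonal ones nonpositive, increases each \<open>d\<^sub>i\<close> and decreases each \<open>r\<^sub>i \<ge> 0\<close>, so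
  it preserves all three conditions. Hence the lower bound, which itself belongs to the
  interval, is the worst case (\<open>double_B_tensor_mono_Z\<close>).\<close>

definition offdiag_abs_sum :: "nat \<Rightarrow> nat \<Rightarrow> tensor \<Rightarrow> nat \<Rightarrow> real" where
  "offdiag_abs_sum m n A i = (\<Sum>t \<in> offdiag_tuples m n i. \<bar>A (i # t)\<bar>)"

lemma offdiag_abs_sum_nonneg: "0 \<le> offdiag_abs_sum m n A i"
  by (simp add: offdiag_abs_sum_def sum_nonneg)

lemma Cons_offdiag_in_index_tuples:
  assumes "m \<ge> 1" "i \<in> {1..n}" "t \<in> offdiag_tuples m n i"
  shows "i # t \<in> index_tuples m n"
  using assms by (auto simp: offdiag_tuples_def index_tuples_def)

lemma Cons_offdiag_not_diagonal:
  assumes "t \<in> offdiag_tuples m n i"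
  shows "\<not> diagonal_index (i # t)"
  using assms by (auto simp: offdiag_tuples_def index_tuples_def diagonal_index_def)

lemma Z_tensor_offdiag_le_0:
  assumes "m \<ge> 1" "Z_tensor m n A" "i \<in> {1..n}" "t \<in> offdiag_tuples m n i"
  shows "A (i # t) \<le> 0"
  using assms Cons_offdiag_in_index_tuples Cons_offdiag_not_diagonal
  unfolding Z_tensor_def by blast

lemma finite_offdiag_tuples: "finite (offdiag_tuples m n i)"
proof -
  have "index_tuples (m - 1) n = {t. set t \<subseteq> {1..n} \<and> length t = m - 1}"
    by (auto simp: index_tuples_def)
  then show ?thesis
    by (simp add: offdiag_tuples_def finite_lists_length_eq)
qed

lemma gamma_plus_Z_tensor:
  assumes "m \<ge> 1" "Z_tensor m n A" "i \<in> {1..n}"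
  shows "gamma_plus m n A i = 0"
  unfolding gamma_plus_def
  by (rule Max_eqI) (use Z_tensor_offdiag_le_0[OF assms] in \<open>auto simp: finite_offdiag_tuples\<close>)

text \<open>Since \<open>\<gamma>\<^sub>i\<^sup>+\<close> vanishes, the terms \<open>\<gamma>\<^sub>i\<^sup>+ - a\<close> of the double B-conditions are \<open>-a = \<bar>a\<bar>\<close>.
  In this form the dependence on the entries is visibly monotone.\<close>

lemma double_B_tensor_Z_iff:
  assumes "m \<ge> 1" "Z_tensor m n A"
  shows "double_B_tensor m n A \<longleftrightarrow>
    (\<forall>i \<in> {1..n}.
       diag_entry m A i > 0 \<and>
       diag_entry m A i \<ge> offdiag_abs_sum m n A i \<and>
       (\<forall>j \<in> {1..n}. j \<noteq> i \<longrightarrow>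
          diag_entry m A i * diag_entry m A j
            > offdiag_abs_sum m n A i * offdiag_abs_sum m n A j))"
proof -
  have sum_eq: "(\<Sum>t \<in> offdiag_tuples m n i. 0 - A (i # t))
      = offdiag_abs_sum m n A i" if "i \<in> {1..n}" for i
    unfolding offdiag_abs_sum_def
    by (rule sum.cong) (use Z_tensor_offdiag_le_0[OF assms that] in auto)
  have "A \<in> tensors m n"
    using assms by (simp add: Z_tensor_def)
  then show ?thesis
    unfolding double_B_tensor_def
    by (simp only: sum_eq gamma_plus_Z_tensor[OF assms] diff_zero simp_thms cong: ball_cong)
qed

lemma diag_entry_mono:
  assumes "tensor_le m n A B" "i \<in> {1..n}"
  shows "diag_entry m A i \<le> diag_entry m B i"
proof -
  have "replicate m i \<in> index_tuples m n"
    using assms(2) by (simp add: index_tuples_def set_replicate_conv_if)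
  then show ?thesis
    using assms(1) by (simp add: tensor_le_def diag_entry_def)
qed

text \<open>Nonpositivity of the entries of the larger tensor \<open>B\<close> is what reverses the order of the
  moduli; that of \<open>A\<close> then follows.\<close>

lemma offdiag_abs_sum_antimono:
  assumes "m \<ge> 1" "Z_tensor m n B" "tensor_le m n A B" "i \<in> {1..n}"
  shows "offdiag_abs_sum m n B i \<le> offdiag_abs_sum m n A i"
  unfolding offdiag_abs_sum_def
proof (rule sum_mono)
  fix t assume t: "t \<in> offdiag_tuples m n i"
  have "A (i # t) \<le> B (i # t)"
    using Cons_offdiag_in_index_tuples[OF assms(1,4) t] assms(3) by (simp add: tensor_le_def)
  moreover have "B (i # t) \<le> 0"
    using Z_tensor_offdiag_le_0[OF assms(1,2,4) t] .
  ultimately show "\<bar>B (i # t)\<bar> \<le> \<bar>A (i # t)\<bar>" by simp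
qed

lemma double_B_tensor_mono_Z:
  assumes m: "m \<ge> 1" and ZA: "Z_tensor m n A" and ZB: "Z_tensor m n B"
    and le: "tensor_le m n A B" and dB: "double_B_tensor m n A"
  shows "double_B_tensor m n B"
  unfolding double_B_tensor_Z_iff[OF m ZB]
proof (intro ballI conjI impI)
  note A = dB[unfolded double_B_tensor_Z_iff[OF m ZA]]
  note diag = diag_entry_mono[OF le]
  note sums = offdiag_abs_sum_antimono[OF m ZB le]
  fix i assume i: "i \<in> {1..n}"
  show "0 < diag_entry m B i"
    using A diag i by fastforce
  show "offdiag_abs_sum m n B i \<le> diag_entry m B i"
    using A diag[OF i] sums[OF i] i by fastforce
  fix j assume j: "j \<in> {1..n}" and ne: "j \<noteq> i"
  have "offdiag_abs_sum m n B i * offdiag_abs_sum m n B j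
      \<le> offdiag_abs_sum m n A i * offdiag_abs_sum m n A j"
    by (intro mult_mono sums i j offdiag_abs_sum_nonneg)
  also have "\<dots> < diag_entry m A i * diag_entry m A j"
    using A i j ne by blast
  also have "\<dots> \<le> diag_entry m B i * diag_entry m B j"
  proof (rule mult_mono)
    show "0 \<le> diag_entry m A j" "0 \<le> diag_entry m B i"
      using A i j \<open>0 < diag_entry m B i\<close> by (auto intro: less_imp_le)
  qed (use diag i j in auto)
  finally show "offdiag_abs_sum m n B i * offdiag_abs_sum m n B j
      < diag_entry m B i * diag_entry m B j" .
qed

theorem proposition4p6:
  fixes m n :: nat and L U :: tensor
  assumes "m \<ge> 1" and "n \<ge> 1"
    and "L \<in> tensors m n" and "U \<in> tensors m n"
    and "tensor_le m n L U"
    and "interval_Z_tensor m n L U"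
  shows "interval_double_B_tensor m n L U \<longleftrightarrow> double_B_tensor m n L"
proof -
  have L: "L \<in> interval_tensor m n L U"
    using assms by (simp add: interval_tensor_def tensor_le_def)
  have Z: "Z_tensor m n A" if "A \<in> interval_tensor m n L U" for A
    using assms(6) that by (simp add: interval_Z_tensor_def)
  show ?thesis
  proof
    assume "interval_double_B_tensor m n L U"
    with L show "double_B_tensor m n L"
      by (simp add: interval_double_B_tensor_def)
  next
    assume dB: "double_B_tensor m n L"
    have "double_B_tensor m n A" if "A \<in> interval_tensor m n L U" for A
    proof (rule double_B_tensor_mono_Z[OF assms(1) Z[OF L] Z[OF that] _ dB])
      show "tensor_le m n L A"
        using that by (simp add: interval_tensor_def)
    qed
    then show "interval_double_B_tensor m n L U"
      by (simp add: interval_double_B_tensor_def)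
  qed
qed

end
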